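(* Let $R,\rho,\nu,C_0,W,P_t,K,I,\gamma,\sigma,\beta_{min}$ be positive real constants and $\mu\in\mathbf{R}$. Let $C\subset\mathbf{R}^2$ be the disc of radius $R$ centered at the origin, $d\Lambda(x)=\frac{\rho}{\nu}\,dx$ on $C$, and let $$p_S(y)=\frac{\xi}{\sqrt{2\pi}\,\sigma y}\exp\left[-\frac{(10\log_{10}y-\mu)^2}{2\sigma^2}\right],\quad y>0,\qquad \xi=\frac{10}{\ln 10}.$$ Let $N_{max}=\left\lceil \frac{C_0}{W\log_2(1+\beta_{min})}\right\rceil$ and, for $x\in C\setminus\{0\}$ and $y>0$, $$N(x,y)=\min\left(N_{max},\ \left\lceil \frac{C_0}{W\log_2\left(1+\dfrac{P_tK}{I\,y\,\|x\|^{\gamma}}\right)}\right\rceil\right).$$ Let $A_0=0$ and, for $j=1,\dots,N_{max}-1$, let $\beta_j=2^{C_0/(Wj)}-1$ and $$A_j=\int_{C\times\mathbf{R}^+}\mathbf{1}_{\{y\|x\|^\gamma\le P_tK/(I\beta_j)\}}\,p_S(y)\,dy\,dx.$$ Then for any function $\theta:\mathbf{R}\to\mathbf{R}$, $$\int_{C\times\mathbf{R}^+}\theta(N(x,y))\,p_S(y)\,dy\,d\Lambda(x)=\frac{\rho}{\nu}\left[\sum_{j=1}^{N_{max}-1}\theta(j)\,(A_j-A_{j-1})+\theta(N_{max})\,(\pi R^2-A_{N_{max}-1})\right].$$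
   Context: $\lceil\cdot\rceil$ is the ceiling function, $\|\cdot\|$ the Euclidean norm on $\mathbf{R}^2$, $\mathbf{R}^+=(0,\infty)$, and $\mathbf{1}$ denotes an indicator function. The value of $N$ at $x=0$ is irrelevant since $\{0\}$ has measure zero. *)

theory Defs
  imports "HOL-Analysis.Analysis"
begin

text \<open>The cell is the closed disc; its boundary is a null set, so taking the open disc instead
  changes none of the integrals.\<close>

definition cell :: "real \<Rightarrow> (real^2) set" where
  "cell R = cball 0 R"

definition Lambda :: "real \<Rightarrow> real \<Rightarrow> real \<Rightarrow> (real^2) measure" where
  "Lambda R \<rho> \<nu> = density lborel (\<lambda>x. ennreal (\<rho> / \<nu>) * indicator (cell R) x)"

text \<open>Only the values at positive arguments are meaningful.\<close>

definition p_S :: "real \<Rightarrow> real \<Rightarrow> real \<Rightarrow> real" where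
  "p_S \<mu> \<sigma> y = (let \<xi> = 10 / ln 10 in
     \<xi> / (sqrt (2 * pi) * \<sigma> * y) * exp (- ((10 * log 10 y - \<mu>)\<^sup>2 / (2 * \<sigma>\<^sup>2))))"

text \<open>For positive parameters the ceiling below is at least 1, so the conversion to \<open>nat\<close>
  loses nothing.\<close>

definition N_max :: "real \<Rightarrow> real \<Rightarrow> real \<Rightarrow> nat" where
  "N_max C\<^sub>0 W \<beta>min = nat \<lceil>C\<^sub>0 / (W * log 2 (1 + \<beta>min))\<rceil>"

text \<open>At \<open>x = 0\<close> this takes the junk value 0 (from division by zero), on a null set.\<close>

definition N_req ::
  "real \<Rightarrow> real \<Rightarrow> real \<Rightarrow> real \<Rightarrow> real \<Rightarrow> real \<Rightarrow> real \<Rightarrow> real^2 \<Rightarrow> real \<Rightarrow> nat" where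
  "N_req C\<^sub>0 W P\<^sub>t K I \<gamma> \<beta>min x y =
     min (N_max C\<^sub>0 W \<beta>min)
         (nat \<lceil>C\<^sub>0 / (W * log 2 (1 + P\<^sub>t * K / (I * y * norm x powr \<gamma>)))\<rceil>)"

definition beta :: "real \<Rightarrow> real \<Rightarrow> nat \<Rightarrow> real" where
  "beta C\<^sub>0 W j = 2 powr (C\<^sub>0 / (W * real j)) - 1"

definition A ::
  "real \<Rightarrow> real \<Rightarrow> real \<Rightarrow> real \<Rightarrow> real \<Rightarrow> real \<Rightarrow> real \<Rightarrow> real \<Rightarrow> real \<Rightarrow> nat \<Rightarrow> real" where
  "A R C\<^sub>0 W P\<^sub>t K I \<gamma> \<mu> \<sigma> j =
     (if j = 0 then 0
      else LINT (x, y) : cell R \<times> {0<..} | lborel \<Otimes>\<^sub>M lborel.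
        indicator {(x, y). y * norm x powr \<gamma> \<le> P\<^sub>t * K / (I * beta C\<^sub>0 W j)} (x, y)
          * p_S \<mu> \<sigma> y)"

end

theory Submission
  imports Defs "HOL-Probability.Distributions"
begin

text \<open>For \<open>x \<noteq> 0\<close>, \<open>y > 0\<close> and \<open>1 \<le> j < N_max\<close>, the event \<open>N(x, y) \<le> j\<close> is exactly the region
  \<open>y \<bar>x\<bar>\<^sup>\<gamma> \<le> P\<^sub>tK / (I \<beta>\<^sub>j)\<close> that defines \<open>A\<^sub>j\<close>. So \<open>\<theta>(N)\<close> is almost everywhere a
  linear combination of the indicators of these nested regions, and it is integrated term by term.
  The total mass \<open>\<pi> R\<^sup>2\<close> comes from \<open>p_S\<close> being a probability density: the substitution
  \<open>u = 10 log 10 y\<close> turns it into the normal density.\<close>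

text \<open>For \<open>1 \<le> j\<close> the bracket is 1 exactly when \<open>n = j\<close>, and the
  last factor is 1 exactly when \<open>n = m\<close>. Only threshold conditions
  \<open>n \<le> j\<close> occur, and these are what the values of \<open>A\<close> measure.\<close>

lemma level_decomposition:
  fixes \<theta> :: "nat \<Rightarrow> real"
  assumes "1 \<le> n" "n \<le> m"
  shows "\<theta> n = (\<Sum>j = 1..m - 1. \<theta> j * (of_bool (n \<le> j) - of_bool (n \<le> j - 1)))
                 + \<theta> m * (1 - of_bool (n \<le> m - 1))"
proof -
  have "(\<Sum>j = 1..m - 1. \<theta> j * (of_bool (n \<le> j) - of_bool (n \<le> j - 1)))
      = (\<Sum>j = 1..m - 1. if n = j then \<theta> j else 0)"
    by (intro sum.cong) auto
  with assms show ?thesis by (cases "n = m") auto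
qed

text \<open>The factor \<open>10 / ln 10 / y\<close> is the derivative of
  \<open>10 / ln 10 * ln y\<close>, so the right-hand side has the shape of a substituted
  integrand.\<close>

lemma p_S_eq_normal_density:
  assumes "y > 0" "\<sigma> > 0"
  shows "p_S \<mu> \<sigma> y = (10 / ln 10 / y) * normal_density \<mu> \<sigma> (10 / ln 10 * ln y)"
  using assms by (simp add: p_S_def Let_def normal_density_def log_def real_sqrt_mult field_simps)

lemma p_S_measurable [measurable]: "p_S \<mu> \<sigma> \<in> borel_measurable borel"
  unfolding p_S_def Let_def by measurable

lemma N_req_measurable [measurable]:
  "(\<lambda>z. N_req C\<^sub>0 W P\<^sub>t K I \<gamma> \<beta>min (fst z) (snd z))
     \<in> measurable (lborel \<Otimes>\<^sub>M lborel) (count_space UNIV)"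
  unfolding N_req_def by measurable

text \<open>Because \<open>j\<close> is strictly below \<open>N_max\<close>, the minimum can be at
  most \<open>j\<close> only through the ceiling. Monotonicity of \<open>log 2\<close> then turns
  the bound into one on the ratio \<open>s\<close>, with \<open>beta\<close> as its
  threshold.\<close>

lemma N_req_le_iff:
  assumes "C\<^sub>0 > 0" "W > 0" "P\<^sub>t > 0" "K > 0" "I > 0" "y > 0" "x \<noteq> 0"
    and "1 \<le> j" "j < N_max C\<^sub>0 W \<beta>min"
  shows "N_req C\<^sub>0 W P\<^sub>t K I \<gamma> \<beta>min x y \<le> j \<longleftrightarrow>
         y * norm x powr \<gamma> \<le> P\<^sub>t * K / (I * beta C\<^sub>0 W j)"
proof -
  define s where "s = P\<^sub>t * K / (I * y * norm x powr \<gamma>)"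
  define r where "r = norm x powr \<gamma>"
  have r: "r > 0" using assms by (simp add: r_def)
  have s: "s > 0" using assms by (simp add: s_def)
  then have l: "log 2 (1 + s) > 0" by simp
  have b: "beta C\<^sub>0 W j > 0"
    using assms by (simp add: beta_def)
  have "N_req C\<^sub>0 W P\<^sub>t K I \<gamma> \<beta>min x y \<le> j \<longleftrightarrow> C\<^sub>0 / (W * log 2 (1 + s)) \<le> real j"
    using assms by (simp add: N_req_def s_def min_le_iff_disj nat_le_iff ceiling_le_iff)
  also have "\<dots> \<longleftrightarrow> C\<^sub>0 / (W * real j) \<le> log 2 (1 + s)"
    using assms l by (simp add: field_simps)
  also have "\<dots> \<longleftrightarrow> 2 powr (C\<^sub>0 / (W * real j)) \<le> 1 + s"
    using s by (simp add: le_log_iff)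
  also have "\<dots> \<longleftrightarrow> beta C\<^sub>0 W j \<le> s"
    by (auto simp: beta_def)
  also have "\<dots> \<longleftrightarrow> y * norm x powr \<gamma> \<le> P\<^sub>t * K / (I * beta C\<^sub>0 W j)"
    using assms b r unfolding s_def r_def[symmetric] by (simp add: field_simps)
  finally show ?thesis .
qed

lemma N_max_ge_1:
  assumes "C\<^sub>0 > 0" "W > 0" "\<beta>min > 0"
  shows "1 \<le> N_max C\<^sub>0 W \<beta>min"
proof -
  have "0 < C\<^sub>0 / (W * log 2 (1 + \<beta>min))" using assms by simp
  then show ?thesis unfolding N_max_def by linarith
qed

text \<open>This lower bound makes level 0 empty, in agreement with \<open>A\<close> being 0 at
  index 0.\<close>

lemma N_req_ge_1:
  assumes "C\<^sub>0 > 0" "W > 0" "P\<^sub>t > 0" "K > 0" "I > 0" "\<beta>min > 0" "y > 0" "x \<noteq> 0"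
  shows "1 \<le> N_req C\<^sub>0 W P\<^sub>t K I \<gamma> \<beta>min x y"
proof -
  have "0 < P\<^sub>t * K / (I * y * norm x powr \<gamma>)" using assms by simp
  then have "0 < log 2 (1 + P\<^sub>t * K / (I * y * norm x powr \<gamma>))"
    by (intro zero_less_log_cancel_iff[THEN iffD2]) linarith+
  then have "0 < C\<^sub>0 / (W * log 2 (1 + P\<^sub>t * K / (I * y * norm x powr \<gamma>)))"
    using assms by (intro divide_pos_pos mult_pos_pos)
  then have "1 \<le> nat \<lceil>C\<^sub>0 / (W * log 2 (1 + P\<^sub>t * K / (I * y * norm x powr \<gamma>)))\<rceil>" by linarith
  with N_max_ge_1[of C\<^sub>0 W \<beta>min] assms show ?thesis unfolding N_req_def by simp
qed

lemma has_bochner_integral_p_S: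
  assumes "\<sigma> > 0"
  shows "has_bochner_integral lborel (\<lambda>y. indicator {0<..} y * p_S \<mu> \<sigma> y) 1"
proof -
  define g where "g y = 10 / ln 10 * ln y" for y :: real
  have "inj_on g {0<..}" by (auto simp: g_def inj_on_def)
  moreover have "(g has_field_derivative 10 / ln 10 / y) (at y within {0<..})" if "y \<in> {0<..}" for y
    using that unfolding g_def by (auto intro!: derivative_eq_intros)
  moreover have "g ` {0<..} = UNIV"
  proof -
    \<comment> \<open>The inverse of \<open>g\<close> is 10 to the power \<open>u / 10\<close>,
      written with \<open>exp\<close>.\<close>
    have "u = g (exp (u * ln 10 / 10))" for u by (simp add: g_def)
    then show ?thesis by (metis UNIV_eq_I exp_gt_zero greaterThan_iff imageI)
  qed
  \<comment> \<open>The change of variables concerns Lebesgue measure, so the normal density moves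
    from \<open>lborel\<close> to its completion; the result is carried back at the end.\<close>
  moreover have "normal_density \<mu> \<sigma> absolutely_integrable_on UNIV"
    using integrable_normal_density[OF assms, of \<mu>]
    by (simp add: set_integrable_def integrable_completion)
  moreover from this have "integral UNIV (normal_density \<mu> \<sigma>) = 1"
    using integral_normal_density[OF assms, of \<mu>]
    by (simp flip: set_lebesgue_integral_eq_integral(2)
        add: set_lebesgue_integral_def integral_completion)
  ultimately have *: "(\<lambda>y. \<bar>10 / ln 10 / y\<bar> * normal_density \<mu> \<sigma> (g y)) absolutely_integrable_on {0<..}
      \<and> integral {0<..} (\<lambda>y. \<bar>10 / ln 10 / y\<bar> * normal_density \<mu> \<sigma> (g y)) = 1"
    by (subst has_absolute_integral_change_of_variables_1') auto
  have eq: "(indicator {0<..} y :: real) *\<^sub>R (\<bar>10 / ln 10 / y\<bar> * normal_density \<mu> \<sigma> (g y))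
      = indicator {0<..} y * p_S \<mu> \<sigma> y" for y
    using assms by (simp add: p_S_eq_normal_density g_def split: split_indicator)
  from * have "(LINT y : {0<..} | lebesgue. \<bar>10 / ln 10 / y\<bar> * normal_density \<mu> \<sigma> (g y)) = 1"
    by (metis set_lebesgue_integral_eq_integral(2))
  with * have "has_bochner_integral lebesgue (\<lambda>y. indicator {0<..} y * p_S \<mu> \<sigma> y) 1"
    unfolding set_lebesgue_integral_def set_integrable_def eq has_bochner_integral_iff by blast
  then show ?thesis
    by (simp add: has_bochner_integral_iff integrable_completion integral_completion)
qed

lemma measure_cell: "R > 0 \<Longrightarrow> measure lborel (cell R) = pi * R\<^sup>2"
  unfolding cell_def by (subst content_cball) (auto simp: unit_ball_vol_2)

text \<open>The integrand is a function of \<open>x\<close> times a function of \<open>y\<close>, so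
  Fubini gives the area of the disc times 1.\<close>

lemma has_bochner_integral_cell_p_S:
  assumes "R > 0" "\<sigma> > 0"
  shows "has_bochner_integral (lborel \<Otimes>\<^sub>M lborel)
           (\<lambda>z. indicator (cell R \<times> {0<..}) z * p_S \<mu> \<sigma> (snd z)) (pi * R\<^sup>2)"
proof -
  have [measurable]: "cell R \<in> sets borel" by (simp add: cell_def)
  have fin: "emeasure lborel (cell R) < \<infinity>"
    by (simp add: cell_def emeasure_bounded_finite bounded_cball flip: infinity_ennreal_def)
  note p = has_bochner_integral_p_S[OF assms(2), of \<mu>, unfolded has_bochner_integral_iff]
  have eq: "indicator (cell R \<times> {0<..}) z * p_S \<mu> \<sigma> (snd z)
      = indicator (cell R) (fst z) * (indicator {0<..} (snd z) * p_S \<mu> \<sigma> (snd z))" for z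
    by (cases z) (auto split: split_indicator)
  \<comment> \<open>For fixed \<open>x\<close> the integral of the absolute value over
    \<open>y\<close> is a constant times the indicator of the cell, and \<open>fin\<close> makes
    that integrable.\<close>
  have int: "integrable (lborel \<Otimes>\<^sub>M lborel)
     (\<lambda>z. indicator (cell R) (fst z) * (indicator {0<..} (snd z) * p_S \<mu> \<sigma> (snd z)))"
    using p fin
    by (intro lborel_pair.Fubini_integrable) (auto simp: abs_mult)
  from lborel_pair.integral_fst'[OF int] int p show ?thesis
    by (simp add: has_bochner_integral_iff eq measure_cell assms)
qed

text \<open>As a density over the measure used in \<open>A\<close>, the product with
  \<open>Lambda\<close> lets both sides of the theorem be integrated against the same
  measure.\<close>

lemma Lambda_pair:
  assumes "\<rho> > 0" "\<nu> > 0"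
  shows "Lambda R \<rho> \<nu> \<Otimes>\<^sub>M (lborel :: real measure)
    = density (lborel \<Otimes>\<^sub>M lborel) (\<lambda>z. ennreal (\<rho> / \<nu> * indicator (cell R) (fst z)))"
proof -
  have [measurable]: "cell R \<in> sets borel" by (simp add: cell_def)
  \<comment> \<open>\<open>lborel\<close> is written with density 1 because
    \<open>pair_measure_density\<close> takes a density in both factors.\<close>
  have "Lambda R \<rho> \<nu> \<Otimes>\<^sub>M lborel = Lambda R \<rho> \<nu> \<Otimes>\<^sub>M density lborel (\<lambda>_::real. 1)"
    by (simp add: density_1)
  also have "\<dots> = density (lborel \<Otimes>\<^sub>M lborel)
      (\<lambda>(x, y). ennreal (\<rho> / \<nu>) * indicator (cell R) x * 1)"
    unfolding Lambda_def
    by (rule pair_measure_density) (auto simp: density_1 lborel.sigma_finite_measure_axioms)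
  also have "(\<lambda>(x, y). ennreal (\<rho> / \<nu>) * indicator (cell R) x * 1)
      = (\<lambda>z::(real^2) \<times> real. ennreal (\<rho> / \<nu> * indicator (cell R) (fst z)))"
    by (auto split: split_indicator)
  finally show ?thesis .
qed

text \<open>Integrability is asserted along with the value because the Bochner integral of a
  non-integrable function defaults to 0.\<close>

theorem theorem3:
  fixes R \<rho> \<nu> C\<^sub>0 W P\<^sub>t K I \<gamma> \<sigma> \<beta>min \<mu> :: real and \<theta> :: "real \<Rightarrow> real"
  assumes "R > 0" "\<rho> > 0" "\<nu> > 0" "C\<^sub>0 > 0" "W > 0" "P\<^sub>t > 0" "K > 0" "I > 0"
    "\<gamma> > 0" "\<sigma> > 0" "\<beta>min > 0"
  defines "Nm \<equiv> N_max C\<^sub>0 W \<beta>min"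
  defines "N \<equiv> N_req C\<^sub>0 W P\<^sub>t K I \<gamma> \<beta>min"
  defines "a \<equiv> A R C\<^sub>0 W P\<^sub>t K I \<gamma> \<mu> \<sigma>"
  shows "set_integrable (Lambda R \<rho> \<nu> \<Otimes>\<^sub>M lborel) (cell R \<times> {0<..})
           (\<lambda>(x, y). \<theta> (real (N x y)) * p_S \<mu> \<sigma> y)
       \<and> (LINT (x, y) : cell R \<times> {0<..} | Lambda R \<rho> \<nu> \<Otimes>\<^sub>M lborel.
            \<theta> (real (N x y)) * p_S \<mu> \<sigma> y)
         = \<rho> / \<nu> * ((\<Sum>j = 1..Nm - 1. \<theta> (real j) * (a j - a (j - 1)))
                      + \<theta> (real Nm) * (pi * R\<^sup>2 - a (Nm - 1)))"
proof -
  have [measurable]: "cell R \<in> sets borel" by (simp add: cell_def)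
  have [measurable]: "(\<lambda>z. N (fst z) (snd z)) \<in> measurable (lborel \<Otimes>\<^sub>M lborel) (count_space UNIV)"
    unfolding N_def by (rule N_req_measurable)
  define g where "g z = indicator (cell R \<times> {0<..}) z * p_S \<mu> \<sigma> (snd z)" for z :: "(real^2) \<times> real"
  \<comment> \<open>The empty set mirrors \<open>A\<close> at index 0; the formula would there use
    \<open>beta\<close> at 0, a junk value from division by zero.\<close>
  define B where "B j = (if j = 0 then {} else
      {z :: (real^2) \<times> real. snd z * norm (fst z) powr \<gamma> \<le> P\<^sub>t * K / (I * beta C\<^sub>0 W j)})" for j
  \<comment> \<open>\<open>T\<close> is the level decomposition of the integrand with indicators as
    truth values, and \<open>V\<close> is its term-by-term integral.\<close>
  define T where "T z = (\<Sum>j = 1..Nm - 1. \<theta> (real j) * (indicator (B j) z * g z - indicator (B (j - 1)) z * g z))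
      + \<theta> (real Nm) * (g z - indicator (B (Nm - 1)) z * g z)" for z
  define V where "V = (\<Sum>j = 1..Nm - 1. \<theta> (real j) * (a j - a (j - 1)))
      + \<theta> (real Nm) * (pi * R\<^sup>2 - a (Nm - 1))"
  have g_int: "has_bochner_integral (lborel \<Otimes>\<^sub>M lborel) g (pi * R\<^sup>2)"
    using has_bochner_integral_cell_p_S[of R \<sigma> \<mu>] assms by (simp add: g_def[abs_def])
  have [measurable]: "g \<in> borel_measurable (lborel \<Otimes>\<^sub>M lborel)"
    using g_int by (rule borel_measurable_has_bochner_integral)
  have [measurable]: "B j \<in> sets (lborel \<Otimes>\<^sub>M lborel)" for j
  proof -
    have "{z \<in> space (lborel \<Otimes>\<^sub>M lborel). snd z * norm (fst z) powr \<gamma> \<le> P\<^sub>t * K / (I * beta C\<^sub>0 W j)}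
        \<in> sets ((lborel :: (real^2) measure) \<Otimes>\<^sub>M (lborel :: real measure))"
      by measurable
    then show ?thesis by (simp add: B_def space_pair_measure)
  qed
  have B_int: "has_bochner_integral (lborel \<Otimes>\<^sub>M lborel) (\<lambda>z. indicator (B j) z * g z) (a j)" for j
  proof (cases "j = 0")
    case True
    then show ?thesis by (simp add: B_def a_def A_def has_bochner_integral_zero)
  next
    case False
    have "integrable (lborel \<Otimes>\<^sub>M lborel) (\<lambda>z. indicator (B j) z * g z)"
      using integrable_mult_indicator[OF \<open>B j \<in> sets (lborel \<Otimes>\<^sub>M lborel)\<close>, of g] g_int
      by (simp add: has_bochner_integral_iff)
    moreover have "a j = (LINT z | (lborel \<Otimes>\<^sub>M lborel). indicator (B j) z * g z)"
      using False unfolding a_def A_def set_lebesgue_integral_def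
      by (auto intro!: Bochner_Integration.integral_cong simp: B_def g_def split: split_indicator)
    ultimately show ?thesis by (simp add: has_bochner_integral_iff)
  qed
  have T_int: "has_bochner_integral (lborel \<Otimes>\<^sub>M lborel) T V"
    unfolding T_def[abs_def] V_def
    by (intro has_bochner_integral_add has_bochner_integral_sum has_bochner_integral_mult_right
        has_bochner_integral_diff B_int g_int)
  \<comment> \<open>The origin is excluded since \<open>N\<close> has a junk value there. Outside
    the region both sides vanish because \<open>g\<close> does.\<close>
  have pointwise: "T z = \<theta> (real (N (fst z) (snd z))) * g z" if "fst z \<noteq> 0" for z
  proof (cases "z \<in> cell R \<times> {0<..}")
    case True
    then obtain x y where z: "z = (x, y)" and y: "y > 0" by auto
    let ?n = "N x y"
    have n: "1 \<le> ?n" "?n \<le> Nm"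
      using N_req_ge_1[of C\<^sub>0 W P\<^sub>t K I \<beta>min y x \<gamma>] assms that y z
      by (auto simp: N_def Nm_def N_req_def)
    \<comment> \<open>Index 0 is separate: \<open>B 0\<close> is empty and \<open>?n\<close> is at
      least 1. Any other \<open>j\<close> here satisfies \<open>j < Nm\<close>, as
      \<open>N_req_le_iff\<close> requires.\<close>
    have ind: "indicator (B j) z = (of_bool (?n \<le> j) :: real)" if "j \<le> Nm - 1" for j
    proof (cases "j = 0")
      case True
      with n show ?thesis by (simp add: B_def)
    next
      case False
      with N_req_le_iff[of C\<^sub>0 W P\<^sub>t K I y x j \<beta>min \<gamma>] assms \<open>fst z \<noteq> 0\<close> y z that n
      show ?thesis by (auto simp: B_def N_def Nm_def indicator_def)
    qed
    have "T z = ((\<Sum>j = 1..Nm - 1. \<theta> (real j) * (of_bool (?n \<le> j) - of_bool (?n \<le> j - 1)))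
                 + \<theta> (real Nm) * (1 - of_bool (?n \<le> Nm - 1))) * g z"
      unfolding T_def distrib_right sum_distrib_right
      by (intro arg_cong2[where f = "(+)"] sum.cong) (auto simp: ind algebra_simps)
    also have "\<dots> = \<theta> (real ?n) * g z"
      using level_decomposition[OF n, of "\<lambda>j. \<theta> (real j)"] by simp
    finally show ?thesis by (simp add: z)
  qed (simp add: T_def g_def)
  have "AE z in (lborel :: (real^2) measure) \<Otimes>\<^sub>M (lborel :: real measure). fst z \<noteq> 0"
  proof (intro lborel_pair.AE_pair_measure)
    show "{z \<in> space (lborel \<Otimes>\<^sub>M lborel). fst z \<noteq> 0}
        \<in> sets ((lborel :: (real^2) measure) \<Otimes>\<^sub>M (lborel :: real measure))"
      by measurable
    show "AE x in (lborel :: (real^2) measure). AE y in (lborel :: real measure). fst (x, y) \<noteq> 0"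
      using AE_lborel_singleton[of 0] by eventually_elim simp
  qed
  then have "AE z in lborel \<Otimes>\<^sub>M lborel. T z = \<theta> (real (N (fst z) (snd z))) * g z"
    by eventually_elim (rule pointwise)
  then have "has_bochner_integral (lborel \<Otimes>\<^sub>M lborel)
      (\<lambda>z. \<theta> (real (N (fst z) (snd z))) * g z) V"
    using T_int by (subst has_bochner_integral_cong_AE[symmetric, of T]) (auto simp: T_def[abs_def])
  then have "has_bochner_integral (lborel \<Otimes>\<^sub>M lborel)
      (\<lambda>z. \<rho> / \<nu> * (\<theta> (real (N (fst z) (snd z))) * g z)) (\<rho> / \<nu> * V)"
    by (rule has_bochner_integral_mult_right)
  \<comment> \<open>The density of \<open>Lambda\<close> brings in a second indicator of the cell,
    absorbed because the region already lies over the cell.\<close>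
  also have "(\<lambda>z. \<rho> / \<nu> * (\<theta> (real (N (fst z) (snd z))) * g z))
      = (\<lambda>z. (\<rho> / \<nu> * indicator (cell R) (fst z)) *\<^sub>R (indicator (cell R \<times> {0<..}) z *\<^sub>R
           (\<lambda>(x, y). \<theta> (real (N x y)) * p_S \<mu> \<sigma> y) z))"
    by (auto simp: g_def split: split_indicator)
  finally have "has_bochner_integral (Lambda R \<rho> \<nu> \<Otimes>\<^sub>M lborel)
      (\<lambda>z. indicator (cell R \<times> {0<..}) z *\<^sub>R (\<lambda>(x, y). \<theta> (real (N x y)) * p_S \<mu> \<sigma> y) z) (\<rho> / \<nu> * V)"
    unfolding Lambda_pair[OF assms(2,3)] using assms
    by (intro has_bochner_integral_density) (auto simp: case_prod_beta)
  then show ?thesis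
    by (simp add: set_integrable_def set_lebesgue_integral_def has_bochner_integral_iff V_def)
qed

end
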